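(* Let $r\ge 2$ and $n\ge 1$ be integers and $0<\varepsilon\le 1$ a real number, and let $p_r$ be the probability that a uniformly random permutation of an $r$-element set has at least one fixed point. Let \[ m=\left\lfloor \frac{\ln(\varepsilon)}{\ln(1-p_r)}\right\rfloor+1 . \] Then there is an integer $N_0$ such that for every $N\ge N_0$ the following holds. If $\mathcal{B}=\{B_1,\ldots,B_N\}$ is a family of $N$ $r$-blocks in $\mathbb{R}^n$, then there exist $m$ colorful transversals $P_1,\ldots,P_m$ of $\mathcal{B}$ such that for every $\mathcal{G}\subset\mathcal{B}$ with $|\mathcal{G}|>\varepsilon|\mathcal{B}|$ there is at least one $k$ with $0\in\operatorname{conv}(P_k(\mathcal{G}))$.
   Context: An $r$-block is an $r\times r$ array of points in $\mathbb{R}^n$ such that the convex hull of each column contains the origin. A colorful transversal of an $r$-block $B$ is a set of $r$ entries of $B$ containing exactly one entry from each column and exactly one entry from each row. A colorful transversal $P$ of a family $\mathcal{B}$ of $r$-blocks is the union of a choice of a colorful transversal for each block; for $\mathcal{G}\subset\mathcal{B}$, $P(\mathcal{G})$ denotes the set of points of $P$ chosen from blocks in $\mathcal{G}$. *)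

theory Defs
  imports "HOL-Probability.Probability" "HOL-Combinatorics.Permutations"
begin

definition fixed_point_prob :: "nat \<Rightarrow> real" where
  "fixed_point_prob r =
     measure_pmf.prob (pmf_of_set {\<pi>. \<pi> permutes {..<r}}) {\<pi>. \<exists>x<r. \<pi> x = x}"

text \<open>An array is a function of row index and column index; only the values at indices
  below \<open>r\<close> matter.\<close>

definition is_block :: "nat \<Rightarrow> (nat \<Rightarrow> nat \<Rightarrow> 'a::real_vector) \<Rightarrow> bool" where
  "is_block r B \<longleftrightarrow> (\<forall>j<r. 0 \<in> convex hull ((\<lambda>i. B i j) ` {..<r}))"

text \<open>Entries are identified with their (row, column) positions, so that entries which
  coincide as points of the space remain distinct entries of the array.\<close>

definition colorful_transversal :: "nat \<Rightarrow> (nat \<times> nat) set \<Rightarrow> bool" where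
  "colorful_transversal r T \<longleftrightarrow>
     T \<subseteq> {..<r} \<times> {..<r} \<and> card T = r \<and>
     (\<forall>j<r. \<exists>!i. (i, j) \<in> T) \<and> (\<forall>i<r. \<exists>!j. (i, j) \<in> T)"

text \<open>A family of \<open>N\<close> blocks is indexed by \<open>{..<N}\<close> (repetitions allowed), and a colorful
  transversal of it is given by the choice of a transversal for each index.\<close>

definition family_transversal :: "nat \<Rightarrow> nat \<Rightarrow> (nat \<Rightarrow> (nat \<times> nat) set) \<Rightarrow> bool" where
  "family_transversal r N P \<longleftrightarrow> (\<forall>b<N. colorful_transversal r (P b))"

definition transversal_points ::
  "(nat \<Rightarrow> nat \<Rightarrow> nat \<Rightarrow> 'a) \<Rightarrow> (nat \<Rightarrow> (nat \<times> nat) set) \<Rightarrow> nat set \<Rightarrow> 'a set" where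
  "transversal_points B P G = (\<Union>b\<in>G. (\<lambda>(i, j). B b i j) ` P b)"

end

theory Submission
  imports Defs
begin

text \<open>
  Choose the transversals at random, by independent uniform permutations. If \<open>G\<close> defeats all of
  them, then each \<open>k\<close> has a direction \<open>v\<^sub>k\<close> whose inner product with every point of \<open>P\<^sub>k(G)\<close> is
  positive. Each column of a block contains a point with nonpositive inner product with \<open>v\<^sub>k\<close>, so
  \<open>P\<^sub>k\<close> avoids one prescribed entry in each column; among all such prescriptions, the avoidance
  probability is largest when the entries lie in distinct rows, where it is \<open>1 - p\<^sub>r\<close>. For fixed
  directions a block is therefore bad with probability at most \<open>(1 - p\<^sub>r)\<^sup>m < \<epsilon>\<close>, and by a Chernoff
  bound more than \<open>\<epsilon>N\<close> blocks are bad with exponentially small probability. By the Sauer--Shelah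
  lemma the directions give only polynomially many sign patterns on the points of the blocks, so a
  union bound finishes the proof.
\<close>

section \<open>Permutations avoiding a function\<close>

definition avoiding_perms :: "nat \<Rightarrow> (nat \<Rightarrow> nat) \<Rightarrow> (nat \<Rightarrow> nat) set" where
  "avoiding_perms r f = {\<pi>. \<pi> permutes {..<r} \<and> (\<forall>j<r. \<pi> j \<noteq> f j)}"

lemma finite_avoiding_perms: "finite (avoiding_perms r f)"
  unfolding avoiding_perms_def by (rule finite_subset[OF _ finite_permutations[of "{..<r}"]]) auto

text \<open>Exchanging the values \<open>a\<close> and \<open>b\<close> sends the permutations lost by the update injectively to
  permutations gained by it, because \<open>b\<close> is not a value of \<open>f\<close>.\<close>

lemma card_avoiding_perms_upd_le:
  assumes j0: "j0 < r" and a: "a < r" "f j0 = a" and b: "b < r" "b \<notin> f ` {..<r}"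
  shows "card (avoiding_perms r f) \<le> card (avoiding_perms r (f(j0 := b)))"
proof -
  define C where "C = {\<pi>. \<pi> permutes {..<r} \<and> (\<forall>j<r. j \<noteq> j0 \<longrightarrow> \<pi> j \<noteq> f j)}"
  define Ca where "Ca = {\<pi>\<in>C. \<pi> j0 = a}"
  define Cb where "Cb = {\<pi>\<in>C. \<pi> j0 = b}"
  have fin: "finite C"
    unfolding C_def by (rule finite_subset[OF _ finite_permutations[of "{..<r}"]]) auto
  have "card Cb \<le> card Ca"
  proof (rule card_inj_on_le)
    show "inj_on (\<lambda>\<pi>. Transposition.transpose a b \<circ> \<pi>) Cb"
      by (rule inj_onI) (metis comp_assoc comp_id id_comp transpose_comp_involutory)
    show "(\<lambda>\<pi>. Transposition.transpose a b \<circ> \<pi>) ` Cb \<subseteq> Ca"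
    proof clarify
      fix \<pi> assume "\<pi> \<in> Cb"
      then have p: "\<pi> permutes {..<r}" "\<pi> j0 = b" "\<And>j. j < r \<Longrightarrow> j \<noteq> j0 \<Longrightarrow> \<pi> j \<noteq> f j"
        by (auto simp: Cb_def C_def)
      have "Transposition.transpose a b \<circ> \<pi> permutes {..<r}"
        using p(1) a b by (intro permutes_compose permutes_swap_id) auto
      moreover have "Transposition.transpose a b (\<pi> j) \<noteq> f j" if j: "j < r" "j \<noteq> j0" for j
      proof -
        have "\<pi> j \<noteq> b"
          using p(1,2) j(2) permutes_inj[OF p(1)] by (metis injD)
        then show ?thesis
          using p(3)[OF j] b(2) j(1) by (auto simp: Transposition.transpose_def split: if_splits)
      qed
      ultimately show "Transposition.transpose a b \<circ> \<pi> \<in> Ca"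
        by (auto simp: Ca_def C_def p(2))
    qed
    show "finite Ca" using fin by (simp add: Ca_def)
  qed
  moreover have "avoiding_perms r f = C - Ca"
    using j0 a by (auto simp: avoiding_perms_def C_def Ca_def)
  moreover have "avoiding_perms r (f(j0 := b)) = C - Cb"
    using j0 by (auto simp: avoiding_perms_def C_def Cb_def)
  moreover have "card (C - Ca) = card C - card Ca" "card (C - Cb) = card C - card Cb"
    using fin by (auto intro!: card_Diff_subset simp: Ca_def Cb_def)
  ultimately show ?thesis by simp
qed

text \<open>An injective \<open>f\<close> is a permutation of the indices, and composing with its
  inverse turns avoidance of \<open>f\<close> into avoidance of the identity.\<close>

lemma card_avoiding_perms_inj:
  assumes f: "f ` {..<r} \<subseteq> {..<r}" and inj: "inj_on f {..<r}"
  shows "card (avoiding_perms r f) \<le> card (avoiding_perms r id)"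
proof -
  \<comment> \<open>\<open>f\<close> is arbitrary from \<open>r\<close> on, while
    \<open>permutes\<close> demands that outside points be fixed.\<close>
  define g where "g = (\<lambda>j. if j < r then f j else j)"
  have "bij_betw g {..<r} {..<r}"
    using f inj by (intro bij_betw_imageI endo_inj_surj) (auto simp: g_def inj_on_def)
  then have g: "g permutes {..<r}"
    by (rule bij_imp_permutes) (auto simp: g_def)
  show ?thesis
  proof (rule card_inj_on_le)
    show "inj_on (\<lambda>\<pi>. inv g \<circ> \<pi>) (avoiding_perms r f)"
      by (rule inj_onI) (metis comp_assoc g id_comp permutes_inv_o(1))
    show "(\<lambda>\<pi>. inv g \<circ> \<pi>) ` avoiding_perms r f \<subseteq> avoiding_perms r id"
    proof clarify
      fix \<pi> assume \<pi>: "\<pi> \<in> avoiding_perms r f"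
      then have "inv g \<circ> \<pi> permutes {..<r}"
        using g by (auto simp: avoiding_perms_def intro: permutes_compose permutes_inv)
      moreover have "inv g (\<pi> j) \<noteq> j" if "j < r" for j
        using \<pi> that permutes_inv_eq[OF g] by (auto simp: avoiding_perms_def g_def)
      ultimately show "inv g \<circ> \<pi> \<in> avoiding_perms r id"
        by (auto simp: avoiding_perms_def)
    qed
  qed (rule finite_avoiding_perms)
qed

text \<open>Derangements are the extreme case. While \<open>f\<close> repeats a value, one of the
  two arguments sharing it can be redirected to a missed value; this never lowers the count, and the
  growing image ends the process at an injective \<open>f\<close>.\<close>

lemma card_avoiding_perms_le:
  assumes "f ` {..<r} \<subseteq> {..<r}"
  shows "card (avoiding_perms r f) \<le> card (avoiding_perms r id)"
  using assms
proof (induction "r - card (f ` {..<r})" arbitrary: f rule: less_induct)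
  case less
  show ?case
  proof (cases "inj_on f {..<r}")
    case True
    then show ?thesis using less.prems card_avoiding_perms_inj by blast
  next
    case False
    then obtain j0 j1 where j: "j0 < r" "j1 < r" "j0 \<noteq> j1" "f j0 = f j1"
      by (auto simp: inj_on_def)
    have "f ` {..<r} \<noteq> {..<r}"
      using False by (metis eq_card_imp_inj_on finite_lessThan)
    then obtain b where b: "b < r" "b \<notin> f ` {..<r}"
      using less.prems by blast
    \<comment> \<open>The old value of \<open>f\<close> at \<open>j0\<close> survives in the image,
      since \<open>j1\<close> still attains it.\<close>
    have img: "(f(j0 := b)) ` {..<r} = insert b (f ` {..<r})"
      using j by (auto simp: image_iff split: if_splits)
    have "card (f ` {..<r}) < r"
      using psubset_card_mono[of "{..<r}" "f ` {..<r}"] less.prems \<open>f ` {..<r} \<noteq> {..<r}\<close> by auto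
    then have "r - card ((f(j0 := b)) ` {..<r}) < r - card (f ` {..<r})"
      unfolding img using b by simp
    moreover have "(f(j0 := b)) ` {..<r} \<subseteq> {..<r}"
      unfolding img using less.prems b by auto
    ultimately have "card (avoiding_perms r (f(j0 := b))) \<le> card (avoiding_perms r id)"
      by (rule less.hyps)
    moreover have "card (avoiding_perms r f) \<le> card (avoiding_perms r (f(j0 := b)))"
      using j less.prems b by (intro card_avoiding_perms_upd_le) auto
    ultimately show ?thesis by linarith
  qed
qed

lemma card_avoiding_perms_id:
  "real (card (avoiding_perms r id)) = (1 - fixed_point_prob r) * fact r"
proof -
  let ?S = "{\<pi>. \<pi> permutes {..<r}}"
  have S: "finite ?S" "?S \<noteq> {}" "card ?S = fact r"
    using permutes_id[of "{..<r}"] by (auto simp: finite_permutations card_permutations[OF refl] simp del: permutes_id)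
  have "avoiding_perms r id = ?S - ?S \<inter> {\<pi>. \<exists>x<r. \<pi> x = x}"
    by (auto simp: avoiding_perms_def)
  then have "real (card (avoiding_perms r id)) = fact r - real (card (?S \<inter> {\<pi>. \<exists>x<r. \<pi> x = x}))"
    using S by (simp add: card_Diff_subset of_nat_diff card_mono[of ?S, simplified S(3)])
  also have "\<dots> = (1 - fixed_point_prob r) * fact r"
    using S by (simp add: fixed_point_prob_def measure_pmf_of_set field_simps)
  finally show ?thesis .
qed

lemma fixed_point_prob_pos:
  assumes "r \<ge> 1"
  shows "0 < fixed_point_prob r"
proof -
  let ?S = "{\<pi>. \<pi> permutes {..<r}}"
  have S: "finite ?S" "?S \<noteq> {}"
    using permutes_id[of "{..<r}"] by (auto simp: finite_permutations simp del: permutes_id)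
  have "id \<in> ?S \<inter> {\<pi>. \<exists>x<r. \<pi> x = x}"
    using assms permutes_id[of "{..<r}"] by (auto intro!: exI[of _ 0])
  then have "card (?S \<inter> {\<pi>. \<exists>x<r. \<pi> x = x}) > 0"
    using S(1) by (subst card_gt_0_iff) blast
  then show ?thesis
    using S by (auto simp: fixed_point_prob_def measure_pmf_of_set card_gt_0_iff)
qed

lemma fixed_point_prob_less_1:
  assumes "r \<ge> 2"
  shows "fixed_point_prob r < 1"
proof -
  \<comment> \<open>The cyclic shift is a derangement as soon as there are two indices.\<close>
  define c where "c = (\<lambda>j. if j < r then Suc j mod r else j)"
  have "inj_on c {..<r}"
    by (auto simp: c_def inj_on_def mod_Suc split: if_splits)
  moreover have "c ` {..<r} \<subseteq> {..<r}"
    using assms by (auto simp: c_def)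
  ultimately have "bij_betw c {..<r} {..<r}"
    by (intro bij_betw_imageI endo_inj_surj) auto
  then have "c permutes {..<r}"
    by (rule bij_imp_permutes) (auto simp: c_def)
  then have "c \<in> avoiding_perms r id"
    using assms by (auto simp: avoiding_perms_def c_def mod_Suc)
  then have "0 < real (card (avoiding_perms r id))"
    using finite_avoiding_perms by (metis card_gt_0_iff empty_iff of_nat_0_less_iff)
  then show ?thesis
    unfolding card_avoiding_perms_id by (simp add: zero_less_mult_iff)
qed

section \<open>Shattering and sign patterns\<close>

definition shattered :: "'a set \<Rightarrow> 'a set set \<Rightarrow> 'a set set" where
  "shattered S F = {Y. Y \<subseteq> S \<and> (\<forall>Z\<subseteq>Y. \<exists>A\<in>F. Y \<inter> A = Z)}"

lemma finite_shattered: "finite S \<Longrightarrow> finite (shattered S F)"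
  unfolding shattered_def by simp

lemma shatteredI:
  assumes "Y \<subseteq> S" "\<And>Z. Z \<subseteq> Y \<Longrightarrow> \<exists>A\<in>F. Y \<inter> A = Z"
  shows "Y \<in> shattered S F"
  using assms by (simp add: shattered_def)

lemma shattered_subset: "Y \<in> shattered S F \<Longrightarrow> Y \<subseteq> S"
  by (simp add: shattered_def)

lemma shatteredE:
  assumes "Y \<in> shattered S F" "Z \<subseteq> Y"
  obtains A where "A \<in> F" "Y \<inter> A = Z"
  using assms by (simp add: shattered_def) blast

text \<open>Pajor's form of the Sauer--Shelah lemma.\<close>

lemma card_le_card_shattered:
  assumes "finite S" "F \<subseteq> Pow S"
  shows "card F \<le> card (shattered S F)"
  using assms
proof (induction S arbitrary: F rule: finite_induct)
  case empty
  then have "F = {} \<or> F = {{}}" by auto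
  moreover have "shattered {} {{}} = {{} :: 'a set}"
    by (auto simp: shattered_def)
  ultimately show ?case
    by (elim disjE) simp_all
next
  case (insert x S)
  \<comment> \<open>Split \<open>F\<close> by membership of \<open>x\<close> and delete
    \<open>x\<close> where present, so that both halves are families on \<open>S\<close> and the
    induction hypothesis applies to each.\<close>
  define F0 where "F0 = {A\<in>F. x \<notin> A}"
  define F1 where "F1 = (\<lambda>A. A - {x}) ` {A\<in>F. x \<in> A}"
  have finF: "finite F"
    by (rule finite_subset[OF insert.prems]) (simp add: insert.hyps)
  have "card F1 = card {A\<in>F. x \<in> A}"
    unfolding F1_def by (intro card_image inj_onI) blast
  moreover have "card F = card F0 + card {A\<in>F. x \<in> A}"
    unfolding F0_def using finF
    by (subst card_Un_disjoint[symmetric]) (auto intro: arg_cong[where f = card])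
  ultimately have F: "card F = card F0 + card F1" by simp
  have "F0 \<subseteq> Pow S" "F1 \<subseteq> Pow S"
    using insert.prems by (auto simp: F0_def F1_def)
  then have le: "card F0 \<le> card (shattered S F0)" "card F1 \<le> card (shattered S F1)"
    using insert.IH by auto
  define U where "U = shattered S F0 \<union> shattered S F1"
  \<comment> \<open>Sets shattered by both halves are counted twice. The second count is charged to
    \<open>insert x Y\<close>, which \<open>F\<close> shatters: traces with \<open>x\<close> come
    from \<open>F1\<close>, traces without it from \<open>F0\<close>.\<close>
  define V where "V = shattered S F0 \<inter> shattered S F1"
  have xS: "x \<notin> Y" if "Y \<in> U \<union> V" for Y
    using that insert.hyps shattered_subset unfolding U_def V_def by blast
  have fin: "finite U" "finite V"
    using insert.hyps by (auto simp: U_def V_def finite_shattered)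
  have "card (shattered S F0) + card (shattered S F1) = card U + card V"
    unfolding U_def V_def using insert.hyps by (intro card_Un_Int finite_shattered)
  also have "card V = card (insert x ` V)"
    using xS by (intro card_image[symmetric] inj_onI) (metis UnI2 insert_ident)
  also have "card U + card (insert x ` V) = card (U \<union> insert x ` V)"
    using fin xS by (intro card_Un_disjoint[symmetric]) auto
  also have "\<dots> \<le> card (shattered (insert x S) F)"
  proof (intro card_mono)
    show "finite (shattered (insert x S) F)"
      using insert.hyps by (simp add: finite_shattered)
    have F1D: "\<exists>A\<in>F. x \<in> A \<and> A' = A - {x}" if "A' \<in> F1" for A'
      using that by (auto simp: F1_def)
    have "Y \<in> shattered (insert x S) F" if Y: "Y \<in> shattered S F0" for Y
    proof -
      have "F0 \<subseteq> F" by (auto simp: F0_def)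
      then show ?thesis using Y unfolding shattered_def by blast
    qed
    moreover have "Y \<in> shattered (insert x S) F" if Y: "Y \<in> shattered S F1" for Y
    proof -
      have "\<exists>A\<in>F. Y \<inter> A = Z" if Z: "Z \<subseteq> Y" for Z
      proof -
        obtain A' where "A' \<in> F1" "Y \<inter> A' = Z"
          using Y Z by (rule shatteredE)
        moreover have "x \<notin> Y" using Y xS by (auto simp: U_def)
        ultimately show ?thesis using F1D[of A'] by blast
      qed
      then show ?thesis using shattered_subset[OF Y] by (intro shatteredI) auto
    qed
    moreover have "insert x Y \<in> shattered (insert x S) F" if Y: "Y \<in> V" for Y
    proof -
      have xY: "x \<notin> Y" using Y xS by auto
      have Y01: "Y \<in> shattered S F0" "Y \<in> shattered S F1"
        using Y by (simp_all add: V_def)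
      have "\<exists>A\<in>F. insert x Y \<inter> A = Z" if Z: "Z \<subseteq> insert x Y" for Z
      proof (cases "x \<in> Z")
        case True
        have "Z - {x} \<subseteq> Y" using Z by auto
        with Y01(2) obtain A' where "A' \<in> F1" "Y \<inter> A' = Z - {x}"
          by (rule shatteredE)
        then show ?thesis using F1D[of A'] True xY by blast
      next
        case False
        then have "Z \<subseteq> Y" using Z by blast
        with Y01(1) obtain A where "A \<in> F0" "Y \<inter> A = Z"
          by (rule shatteredE)
        then show ?thesis unfolding F0_def by blast
      qed
      then show ?thesis using shattered_subset[OF Y01(1)] by (intro shatteredI) auto
    qed
    ultimately show "U \<union> insert x ` V \<subseteq> shattered (insert x S) F"
      by (auto simp: U_def)
  qed
  finally show ?case using F le by linarith
qed

text \<open>The traces on \<open>S\<close> of open half-spaces with 0 on the boundary;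
  \<open>v = 0\<close> contributes the empty trace.\<close>

definition sign_patterns :: "'a::real_inner set \<Rightarrow> 'a set set" where
  "sign_patterns S = range (\<lambda>v. {x\<in>S. 0 < v \<bullet> x})"

text \<open>More vectors than the dimension satisfy a nontrivial linear relation. Shattering would
  give a \<open>v\<close> positive exactly on the vectors with positive coefficient, so pairing the
  relation with \<open>v\<close> would yield a positive number instead of 0.\<close>

lemma card_shattered_sign_patterns:
  fixes S :: "'a::euclidean_space set"
  assumes "finite S" and Y: "Y \<in> shattered S (sign_patterns S)"
  shows "card Y \<le> DIM('a)"
proof (rule ccontr)
  assume "\<not> card Y \<le> DIM('a)"
  then have "dependent Y"
    using dependent_biggerset[of Y] assms finite_subset[of Y S] by (auto simp: shattered_def)
  have "finite Y" "Y \<subseteq> S"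
    using assms finite_subset by (auto simp: shattered_def)
  then obtain u where u: "\<exists>y\<in>Y. u y \<noteq> 0" "(\<Sum>y\<in>Y. u y *\<^sub>R y) = 0"
    using \<open>dependent Y\<close> by (auto simp: dependent_finite)
  \<comment> \<open>Negating the relation if necessary secures a positive coefficient, which makes
    the sum below strictly positive.\<close>
  obtain w where w: "\<exists>y\<in>Y. 0 < w y" "(\<Sum>y\<in>Y. w y *\<^sub>R y) = 0"
  proof (cases "\<exists>y\<in>Y. 0 < u y")
    case True
    then show ?thesis using u that by blast
  next
    case False
    then have "\<exists>y\<in>Y. 0 < - u y" using u(1) by force
    moreover have "(\<Sum>y\<in>Y. (- u y) *\<^sub>R y) = 0" using u(2) by (simp add: sum_negf)
    ultimately show ?thesis using that[of "\<lambda>y. - u y"] by blast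
  qed
  obtain v where "Y \<inter> {x\<in>S. 0 < v \<bullet> x} = {y\<in>Y. 0 < w y}"
    using Y unfolding shattered_def sign_patterns_def by fastforce
  then have v: "0 < v \<bullet> y \<longleftrightarrow> 0 < w y" if "y \<in> Y" for y
    using that \<open>Y \<subseteq> S\<close> by blast
  have "0 < (\<Sum>y\<in>Y. w y * (v \<bullet> y))"
  proof -
    obtain y where "y \<in> Y" "0 < w y" using w by blast
    then show ?thesis
      using \<open>finite Y\<close> v by (intro sum_pos2[of _ y]) (force simp: zero_le_mult_iff)+
  qed
  also have "\<dots> = v \<bullet> (\<Sum>y\<in>Y. w y *\<^sub>R y)"
    by (simp add: inner_sum_right)
  finally show False using w by simp
qed

text \<open>Such a subset is listed by a word of length exactly \<open>d\<close> over the elements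
  of \<open>S\<close> and the padding letter \<open>None\<close>.\<close>

lemma card_subsets_le:
  assumes "finite S"
  shows "card {Y. Y \<subseteq> S \<and> card Y \<le> d} \<le> (card S + 1) ^ d"
proof -
  let ?L = "{xs :: 'a option list. set xs \<subseteq> insert None (Some ` S) \<and> length xs = d}"
  have fin: "finite ?L"
    using assms by (intro finite_lists_length_eq) auto
  have "{Y. Y \<subseteq> S \<and> card Y \<le> d} \<subseteq> (\<lambda>xs. {x. Some x \<in> set xs}) ` ?L"
  proof clarify
    fix Y assume Y: "Y \<subseteq> S" "card Y \<le> d"
    then obtain ys where ys: "set ys = Y" "distinct ys"
      using assms finite_distinct_list finite_subset by metis
    then have "length ys \<le> d" using Y distinct_card by fastforce
    then show "Y \<in> (\<lambda>xs. {x. Some x \<in> set xs}) ` ?L"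
      using ys Y by (intro image_eqI[of _ _ "map Some ys @ replicate (d - length ys) None"]) auto
  qed
  then have "card {Y. Y \<subseteq> S \<and> card Y \<le> d} \<le> card ?L"
    using fin by (meson card_image_le card_mono finite_imageI le_trans)
  also have "\<dots> = (card S + 1) ^ d"
    using assms by (subst card_lists_length_eq) (auto simp: card_image)
  finally show ?thesis .
qed

lemma card_sign_patterns_le:
  fixes S :: "'a::euclidean_space set"
  assumes "finite S"
  shows "card (sign_patterns S) \<le> (card S + 1) ^ DIM('a)"
proof -
  have "card (sign_patterns S) \<le> card (shattered S (sign_patterns S))"
    using assms by (intro card_le_card_shattered) (auto simp: sign_patterns_def)
  also have "\<dots> \<le> card {Y. Y \<subseteq> S \<and> card Y \<le> DIM('a)}"
    using assms card_shattered_sign_patterns[OF assms]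
    by (intro card_mono) (auto simp: shattered_def)
  also have "\<dots> \<le> (card S + 1) ^ DIM('a)"
    by (rule card_subsets_le[OF assms])
  finally show ?thesis .
qed

lemma finite_sign_patterns: "finite S \<Longrightarrow> finite (sign_patterns S)"
  by (rule finite_subset[of _ "Pow S"]) (auto simp: sign_patterns_def)

section \<open>Chernoff and union bounds\<close>

text \<open>Chernoff's bound for the uniform distribution on \<open>X\<^sup>N\<close>, in terms of the moment
  \<open>t\<^sup>Z\<close> of the number \<open>Z\<close> of hits.\<close>

lemma card_many_hits_le:
  fixes q t \<epsilon> :: real
  assumes X: "finite X" and t: "1 \<le> t"
    and A: "\<And>b. b < N \<Longrightarrow> A b \<subseteq> X" "\<And>b. b < N \<Longrightarrow> real (card (A b)) \<le> q * real (card X)"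
  shows "real (card {h \<in> {..<N} \<rightarrow>\<^sub>E X. \<epsilon> * N < card {b. b < N \<and> h b \<in> A b}}) * t powr (\<epsilon> * N)
    \<le> ((1 + (t - 1) * q) * card X) ^ N"
proof -
  let ?H = "{..<N} \<rightarrow>\<^sub>E X" and ?Z = "\<lambda>h. card {b. b < N \<and> h b \<in> A b}"
  let ?w = "\<lambda>b x. if x \<in> A b then t else 1"
  have finH: "finite ?H" using X by (intro finite_PiE) auto
  have "real (card {h \<in> ?H. \<epsilon> * N < ?Z h}) * t powr (\<epsilon> * N)
      = (\<Sum>h\<in>{h \<in> ?H. \<epsilon> * N < ?Z h}. t powr (\<epsilon> * N))"
    by simp
  \<comment> \<open>Markov's inequality in counting form.\<close>
  also have "\<dots> \<le> (\<Sum>h\<in>{h \<in> ?H. \<epsilon> * N < ?Z h}. t ^ ?Z h)"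
  proof (intro sum_mono)
    fix h assume "h \<in> {h \<in> ?H. \<epsilon> * N < ?Z h}"
    then have "t powr (\<epsilon> * N) \<le> t powr real (?Z h)"
      using t by (intro powr_mono) auto
    then show "t powr (\<epsilon> * N) \<le> t ^ ?Z h"
      using t by (simp add: powr_realpow)
  qed
  also have "\<dots> \<le> (\<Sum>h\<in>?H. t ^ ?Z h)"
    using finH t by (intro sum_mono2) auto
  \<comment> \<open>The moment is a product over coordinates, so summing over the product space
    factors; this is where independence enters.\<close>
  also have "\<dots> = (\<Sum>h\<in>?H. \<Prod>b<N. ?w b (h b))"
  proof (intro sum.cong refl)
    fix h
    have "(\<Prod>b<N. ?w b (h b)) = (\<Prod>b\<in>{b\<in>{..<N}. h b \<in> A b}. t)"
      by (rule prod.inter_filter[symmetric]) simp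
    then show "t ^ ?Z h = (\<Prod>b<N. ?w b (h b))" by simp
  qed
  also have "\<dots> = (\<Prod>b<N. \<Sum>x\<in>X. ?w b x)"
    using X by (intro prod_sum_PiE[symmetric]) auto
  also have "\<dots> \<le> (\<Prod>b<N. (1 + (t - 1) * q) * card X)"
  proof (intro prod_mono conjI)
    fix b assume b: "b \<in> {..<N}"
    show "0 \<le> (\<Sum>x\<in>X. ?w b x)" using t by (intro sum_nonneg) auto
    have "(\<Sum>x\<in>X. ?w b x) = (\<Sum>x\<in>X. 1 + (if x \<in> A b then t - 1 else 0))"
      by (intro sum.cong) auto
    also have "\<dots> = card X + (t - 1) * card (A b)"
      using X A(1)[of b] b by (simp add: sum.distrib sum.If_cases Int_absorb1)
    also have "\<dots> \<le> card X + (t - 1) * (q * card X)"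
      using A(2)[of b] b t by (intro add_left_mono mult_left_mono) auto
    finally show "(\<Sum>x\<in>X. ?w b x) \<le> (1 + (t - 1) * q) * card X"
      by (simp add: algebra_simps)
  qed
  finally show ?thesis by simp
qed

text \<open>Union bound over \<open>I\<close>: if every \<open>h\<close> had too many hits for some
  \<open>i\<close>, the exceptional sets would cover the whole product space, but by the Chernoff
  bound and \<open>small\<close> their sizes add up to less than its size.\<close>

lemma exists_few_hits:
  fixes q t \<epsilon> :: real and A :: "'i \<Rightarrow> nat \<Rightarrow> 'x set"
  assumes X: "finite X" "X \<noteq> {}" and t: "1 \<le> t" and I: "finite I"
    and A: "\<And>i b. i \<in> I \<Longrightarrow> b < N \<Longrightarrow> A i b \<subseteq> X"
      "\<And>i b. i \<in> I \<Longrightarrow> b < N \<Longrightarrow> real (card (A i b)) \<le> q * real (card X)"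
    and small: "real (card I) * (1 + (t - 1) * q) ^ N < t powr (\<epsilon> * N)"
  shows "\<exists>h \<in> {..<N} \<rightarrow>\<^sub>E X. \<forall>i\<in>I. card {b. b < N \<and> h b \<in> A i b} \<le> \<epsilon> * N"
proof (rule ccontr)
  let ?H = "{..<N} \<rightarrow>\<^sub>E X"
  let ?M = "\<lambda>i. {h \<in> ?H. \<epsilon> * N < card {b. b < N \<and> h b \<in> A i b}}"
  assume "\<not> ?thesis"
  then have sub: "?H \<subseteq> (\<Union>i\<in>I. ?M i)" by force
  have finH: "finite ?H" using X by (intro finite_PiE) auto
  have cX: "0 < real (card X) ^ N" using X by (simp add: card_gt_0_iff)
  have "card ?H \<le> card (\<Union>i\<in>I. ?M i)"
    using finH I sub by (intro card_mono) auto
  also have "\<dots> \<le> (\<Sum>i\<in>I. card (?M i))"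
    by (rule card_UN_le[OF I])
  finally have "real (card X) ^ N \<le> (\<Sum>i\<in>I. real (card (?M i)))"
    by (simp add: card_PiE flip: of_nat_power of_nat_sum)
  then have "real (card X) ^ N * t powr (\<epsilon> * N) \<le> (\<Sum>i\<in>I. real (card (?M i)) * t powr (\<epsilon> * N))"
    by (subst sum_distrib_right[symmetric]) (intro mult_right_mono, auto)
  also have "\<dots> \<le> (\<Sum>i\<in>I. ((1 + (t - 1) * q) * card X) ^ N)"
    using X t A by (intro sum_mono card_many_hits_le) auto
  also have "\<dots> = real (card X) ^ N * (real (card I) * (1 + (t - 1) * q) ^ N)"
    by (simp add: power_mult_distrib)
  also have "\<dots> < real (card X) ^ N * t powr (\<epsilon> * N)"
    using small cX by (rule mult_strict_left_mono)
  finally show False by simp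
qed

text \<open>Both sides equal 1 at \<open>t = 1\<close>, where their slopes are \<open>q\<close> and
  \<epsilon>, so the right side is larger just beyond 1.\<close>

lemma exists_chernoff_parameter:
  fixes q \<epsilon> :: real
  assumes "q < \<epsilon>"
  shows "\<exists>t>1. 1 + (t - 1) * q < t powr \<epsilon>"
proof -
  have "((\<lambda>t. t powr \<epsilon> - (1 + (t - 1) * q)) has_real_derivative (\<epsilon> - q)) (at 1)"
    by (auto intro!: derivative_eq_intros)
  from DERIV_pos_inc_right[OF this] assms
  obtain d where d: "0 < d"
    "\<And>h. 0 < h \<Longrightarrow> h < d \<Longrightarrow> 1 powr \<epsilon> - (1 + (1 - 1) * q) < (1 + h) powr \<epsilon> - (1 + ((1 + h) - 1) * q)"
    by auto
  show ?thesis
    using d(1) d(2)[of "d / 2"] by (intro exI[of _ "1 + d / 2"]) auto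
qed

text \<open>After division by \<open>x ^ N\<close>, a polynomial is compared with the exponential of
  \<open>s * N\<close>, where \<open>s\<close> is the logarithm of \<open>y / x\<close>.\<close>

lemma eventually_poly_times_power_less:
  fixes x y c :: real
  assumes "0 < x" "x < y" "0 \<le> c"
  shows "\<forall>\<^sub>F N in sequentially. (real N * c + 1) ^ k * x ^ N < y ^ N"
proof -
  define s where "s = ln (y / x)"
  have s: "0 < s" using assms by (simp add: s_def)
  \<comment> \<open>For \<open>N\<close> at least 1, \<open>N * c + 1\<close> is at most
    \<open>(c + 1) * N\<close>; \<open>K\<close> is the factor left when the power of this is
    written in terms of \<open>s * N\<close>.\<close>
  define K where "K = ((c + 1) / s) ^ k"
  have K: "0 < K" using s assms by (simp add: K_def)
  have "((\<lambda>z::real. z ^ k / exp z) \<longlongrightarrow> 0) at_top"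
    by (rule tendsto_power_div_exp_0)
  moreover have "filterlim (\<lambda>N. s * real N) at_top sequentially"
    using s by (intro filterlim_tendsto_pos_mult_at_top[OF tendsto_const] filterlim_real_sequentially)
  ultimately have "(\<lambda>N. (s * real N) ^ k / exp (s * real N)) \<longlonglongrightarrow> 0"
    by (rule filterlim_compose)
  then have "\<forall>\<^sub>F N in sequentially. (s * real N) ^ k / exp (s * real N) < 1 / K"
    using K by (intro order_tendstoD(2)) auto
  then show ?thesis
    using eventually_ge_at_top[of 1]
  proof eventually_elim
    case (elim N)
    have "real N * c + 1 \<le> (c + 1) / s * (s * real N)"
      using elim s by (simp add: field_simps)
    then have "(real N * c + 1) ^ k \<le> K * (s * real N) ^ k"
      unfolding K_def power_mult_distrib[symmetric] using assms by (intro power_mono) auto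
    also have "\<dots> < exp (s * real N)"
      using elim K by (simp add: field_simps)
    also have "\<dots> = (y / x) ^ N"
      using assms by (simp add: s_def exp_of_nat2_mult)
    finally show ?case
      using assms by (simp add: power_divide field_simps)
  qed
qed

section \<open>Transversals of blocks\<close>

lemma colorful_transversal_of_perm:
  assumes "\<pi> permutes {..<r}"
  shows "colorful_transversal r ((\<lambda>j. (\<pi> j, j)) ` {..<r})"
proof -
  have "\<exists>!j. j < r \<and> i = \<pi> j" if "i < r" for i
    using that assms permutes_inv_eq[OF assms] permutes_in_image[OF permutes_inv[OF assms]]
    by (metis lessThan_iff)
  moreover have "card ((\<lambda>j. (\<pi> j, j)) ` {..<r}) = r"
    by (subst card_image) (auto simp: inj_on_def)
  ultimately show ?thesis
    using permutes_in_image[OF assms] by (auto simp: colorful_transversal_def image_iff)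
qed

text \<open>Otherwise the open half-space of \<open>v\<close>, being convex, would contain the hull
  of the column and hence 0.\<close>

lemma block_column_nonpos:
  fixes B :: "nat \<Rightarrow> nat \<Rightarrow> 'a::real_inner"
  assumes "is_block r B" "j < r"
  shows "\<exists>i<r. v \<bullet> B i j \<le> 0"
proof (rule ccontr)
  assume "\<not> ?thesis"
  then have "(\<lambda>i. B i j) ` {..<r} \<subseteq> {x. 0 < v \<bullet> x}" by auto
  then have "convex hull ((\<lambda>i. B i j) ` {..<r}) \<subseteq> {x. 0 < v \<bullet> x}"
    by (rule hull_minimal) (rule convex_halfspace_gt)
  then show False using assms by (auto simp: is_block_def)
qed

text \<open>With \<open>f\<close> choosing in each column an entry of nonpositive inner product with
  \<open>v\<close>, every permutation counted here avoids \<open>f\<close>.\<close>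

lemma card_perms_in_halfspace_le:
  fixes B :: "nat \<Rightarrow> nat \<Rightarrow> 'a::real_inner"
  assumes "is_block r B"
  shows "card {\<pi>. \<pi> permutes {..<r} \<and> (\<forall>j<r. 0 < v \<bullet> B (\<pi> j) j)} \<le> card (avoiding_perms r id)"
proof -
  obtain f where f: "\<And>j. j < r \<Longrightarrow> f j < r \<and> v \<bullet> B (f j) j \<le> 0"
    using block_column_nonpos[OF assms, of _ v] by metis
  have "{\<pi>. \<pi> permutes {..<r} \<and> (\<forall>j<r. 0 < v \<bullet> B (\<pi> j) j)} \<subseteq> avoiding_perms r f"
    using f by (force simp: avoiding_perms_def)
  then have "card {\<pi>. \<pi> permutes {..<r} \<and> (\<forall>j<r. 0 < v \<bullet> B (\<pi> j) j)} \<le> card (avoiding_perms r f)"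
    by (intro card_mono finite_avoiding_perms)
  also have "\<dots> \<le> card (avoiding_perms r id)"
    using f by (intro card_avoiding_perms_le) auto
  finally show ?thesis .
qed

lemma finite_separated_from_0:
  fixes S :: "'a::euclidean_space set"
  assumes "finite S" "0 \<notin> convex hull S"
  shows "\<exists>v. \<forall>x\<in>S. 0 < v \<bullet> x"
proof -
  have "closed (convex hull S)"
    using assms by (simp add: compact_imp_closed finite_imp_compact_convex_hull)
  from separating_hyperplane_closed_0[OF convex_convex_hull this assms(2)]
  obtain v b where "0 < b" "\<forall>x\<in>convex hull S. b < v \<bullet> x" by auto
  then show ?thesis
    using hull_subset[of S convex] by (intro exI[of _ v]) force
qed

text \<open>The hypothesis \<open>small\<close> is the union bound: its first factor bounds the
  number of \<open>m\<close>-tuples of sign patterns on at most \<open>N * r\<^sup>2\<close> points,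
  and the rest is the Chernoff estimate for a single tuple.\<close>

lemma exists_transversals:
  fixes B :: "nat \<Rightarrow> nat \<Rightarrow> nat \<Rightarrow> 'a::euclidean_space"
  assumes block: "\<And>b. b < N \<Longrightarrow> is_block r (B b)" and t: "1 \<le> t"
    and small: "(real N * real (r\<^sup>2) + 1) ^ (DIM('a) * m)
      * (1 + (t - 1) * (1 - fixed_point_prob r) ^ m) ^ N < t powr (\<epsilon> * N)"
    and p: "fixed_point_prob r \<le> 1"
  shows "\<exists>P. (\<forall>k<m. family_transversal r N (P k)) \<and>
      (\<forall>G \<subseteq> {..<N}. real (card G) > \<epsilon> * real N \<longrightarrow>
        (\<exists>k<m. 0 \<in> convex hull (transversal_points B (P k) G)))"
proof -
  let ?q = "(1 - fixed_point_prob r) ^ m"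
  define S where "S = (\<lambda>(b, i, j). B b i j) ` ({..<N} \<times> {..<r} \<times> {..<r})"
  \<comment> \<open>One outcome for one block records its permutations in all \<open>m\<close>
    transversals, so the blocks become the independent coordinates.\<close>
  define X where "X = {..<m} \<rightarrow>\<^sub>E {\<pi>. \<pi> permutes {..<r}}"
  define I where "I = {..<m} \<rightarrow>\<^sub>E sign_patterns S"
  \<comment> \<open>The outcomes bad for block \<open>b\<close>: for every \<open>k\<close>, all
    entries chosen by the \<open>k\<close>-th permutation lie on the positive side prescribed by
    \<sigma>.\<close>
  define A where "A = (\<lambda>\<sigma> b.
    PiE {..<m} (\<lambda>k. {\<pi>. \<pi> permutes {..<r} \<and> (\<forall>j<r. B b (\<pi> j) j \<in> \<sigma> k)}))"
  have finS: "finite S" by (simp add: S_def)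
  have "card S \<le> card ({..<N} \<times> {..<r} \<times> {..<r})"
    unfolding S_def by (rule card_image_le) simp
  then have cardS: "card S \<le> N * r\<^sup>2"
    by (simp add: card_cartesian_product power2_eq_square)
  have X: "finite X" "X \<noteq> {}" "card X = fact r ^ m"
    unfolding X_def using permutes_id[of "{..<r}"]
    by (auto intro!: finite_PiE simp: finite_permutations PiE_eq_empty_iff card_PiE
        card_permutations[OF refl] simp del: permutes_id)
  have I: "finite I"
    unfolding I_def using finS by (intro finite_PiE) (auto simp: finite_sign_patterns)
  have "card I = card (sign_patterns S) ^ m"
    by (simp add: I_def card_PiE)
  also have "\<dots> \<le> ((card S + 1) ^ DIM('a)) ^ m"
    by (intro power_mono card_sign_patterns_le finS) simp
  also have "\<dots> \<le> ((N * r\<^sup>2 + 1) ^ DIM('a)) ^ m"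
    using cardS by (intro power_mono) auto
  finally have "card I \<le> (N * r\<^sup>2 + 1) ^ (DIM('a) * m)"
    by (simp add: power_mult)
  then have cardI: "real (card I) \<le> (real N * real (r\<^sup>2) + 1) ^ (DIM('a) * m)"
    by (metis (no_types, lifting) of_nat_1 of_nat_add of_nat_le_iff of_nat_mult of_nat_power)
  have AX: "A \<sigma> b \<subseteq> X" for \<sigma> b
    unfolding A_def X_def by (intro PiE_mono) auto
  have cardA: "real (card (A \<sigma> b)) \<le> ?q * real (card X)" if \<sigma>: "\<sigma> \<in> I" and b: "b < N" for \<sigma> b
  proof -
    let ?C = "\<lambda>k. {\<pi>. \<pi> permutes {..<r} \<and> (\<forall>j<r. B b (\<pi> j) j \<in> \<sigma> k)}"
    have "card (?C k) \<le> card (avoiding_perms r id)" if k: "k < m" for k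
    proof -
      obtain v where v: "\<sigma> k = {x\<in>S. 0 < v \<bullet> x}"
        using \<sigma> k unfolding I_def sign_patterns_def by (auto dest: PiE_mem)
      have "card (?C k) \<le> card {\<pi>. \<pi> permutes {..<r} \<and> (\<forall>j<r. 0 < v \<bullet> B b (\<pi> j) j)}"
        unfolding v
        by (intro card_mono finite_subset[OF _ finite_permutations[of "{..<r}"]]) auto
      also have "\<dots> \<le> card (avoiding_perms r id)"
        using block[OF b] by (rule card_perms_in_halfspace_le)
      finally show ?thesis .
    qed
    then have "card (A \<sigma> b) \<le> card (avoiding_perms r id) ^ m"
      unfolding A_def using prod_mono[of "{..<m}" "\<lambda>k. card (?C k)" "\<lambda>_. card (avoiding_perms r id)"]
      by (simp add: card_PiE)
    then have "real (card (A \<sigma> b)) \<le> real (card (avoiding_perms r id)) ^ m"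
      by (simp flip: of_nat_power)
    also have "\<dots> = ?q * real (card X)"
      unfolding card_avoiding_perms_id X(3) by (simp add: power_mult_distrib)
    finally show ?thesis .
  qed
  have "real (card I) * (1 + (t - 1) * ?q) ^ N \<le>
      (real N * real (r\<^sup>2) + 1) ^ (DIM('a) * m) * (1 + (t - 1) * ?q) ^ N"
    using cardI t p by (intro mult_right_mono) auto
  then have "real (card I) * (1 + (t - 1) * ?q) ^ N < t powr (\<epsilon> * N)"
    using small by linarith
  from exists_few_hits[where A = A, OF X(1,2) t I AX cardA this]
  obtain h where h: "h \<in> {..<N} \<rightarrow>\<^sub>E X"
    "\<And>\<sigma>. \<sigma> \<in> I \<Longrightarrow> card {b. b < N \<and> h b \<in> A \<sigma> b} \<le> \<epsilon> * N"
    by blast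
  have perm: "h b k permutes {..<r}" if "b < N" "k < m" for b k
    using h(1) that unfolding X_def by (auto dest!: PiE_mem)
  define P where "P = (\<lambda>k b. (\<lambda>j. (h b k j, j)) ` {..<r})"
  show ?thesis
  proof (intro exI[of _ P] conjI allI impI)
    fix k assume "k < m"
    then show "family_transversal r N (P k)"
      unfolding family_transversal_def P_def by (auto intro: colorful_transversal_of_perm perm)
  next
    fix G assume G: "G \<subseteq> {..<N}" "\<epsilon> * real N < real (card G)"
    show "\<exists>k<m. 0 \<in> convex hull (transversal_points B (P k) G)"
    proof (rule ccontr)
      assume neg: "\<not> ?thesis"
      have "finite G" using G finite_subset by blast
      then have "finite (transversal_points B (P k) G)" for k
        by (auto simp: transversal_points_def P_def)
      then have "\<exists>v. \<forall>x\<in>transversal_points B (P k) G. 0 < v \<bullet> x" if "k < m" for k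
        using neg that finite_separated_from_0 by blast
      then obtain v where v: "\<And>k x. k < m \<Longrightarrow> x \<in> transversal_points B (P k) G \<Longrightarrow> 0 < v k \<bullet> x"
        by metis
      \<comment> \<open>The separating directions depend on \<open>h\<close>, but their patterns
        form a member of the fixed index set \<open>I\<close>. Every block of \<open>G\<close> is
        bad for it, so \<open>G\<close> is too small.\<close>
      define \<sigma> where "\<sigma> = (\<lambda>k\<in>{..<m}. {x\<in>S. 0 < v k \<bullet> x})"
      have "\<sigma> \<in> I"
        by (auto simp: \<sigma>_def I_def sign_patterns_def)
      have "h b \<in> A \<sigma> b" if b: "b \<in> G" for b
      proof -
        have bN: "b < N" using b G by auto
        have "B b (h b k j) j \<in> \<sigma> k" if kj: "k < m" "j < r" for k j
        proof -
          have "B b (h b k j) j \<in> transversal_points B (P k) G"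
            using b kj by (force simp: transversal_points_def P_def)
          moreover have "h b k j < r"
            using permutes_in_image[OF perm[OF bN kj(1)], of j] kj by simp
          ultimately show ?thesis
            using v[OF kj(1)] kj bN by (force simp: \<sigma>_def S_def)
        qed
        moreover have "h b \<in> X" using h(1) bN by auto
        ultimately show ?thesis
          unfolding A_def X_def by (auto simp: PiE_iff)
      qed
      then have "G \<subseteq> {b. b < N \<and> h b \<in> A \<sigma> b}" using G by auto
      then have "card G \<le> card {b. b < N \<and> h b \<in> A \<sigma> b}"
        by (intro card_mono) auto
      then show False using h(2)[OF \<open>\<sigma> \<in> I\<close>] G(2) by linarith
    qed
  qed
qed

theorem theorem4p4:
  fixes r m :: nat and \<epsilon> :: real
  assumes "r \<ge> 2" and "0 < \<epsilon>" and "\<epsilon> \<le> 1"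
    and "int m = \<lfloor>ln \<epsilon> / ln (1 - fixed_point_prob r)\<rfloor> + 1"
  shows "\<exists>N\<^sub>0. \<forall>N\<ge>N\<^sub>0. \<forall>B :: nat \<Rightarrow> nat \<Rightarrow> nat \<Rightarrow> real ^ 'n.
    (\<forall>b<N. is_block r (B b)) \<longrightarrow>
    (\<exists>P :: nat \<Rightarrow> nat \<Rightarrow> (nat \<times> nat) set.
      (\<forall>k<m. family_transversal r N (P k)) \<and>
      (\<forall>G \<subseteq> {..<N}. real (card G) > \<epsilon> * real N \<longrightarrow>
        (\<exists>k<m. 0 \<in> convex hull (transversal_points B (P k) G))))"
proof -
  define p where "p = fixed_point_prob r"
  have p: "0 < p" "p < 1"
    using assms(1) fixed_point_prob_pos fixed_point_prob_less_1 by (auto simp: p_def)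
  define q where "q = (1 - p) ^ m"
  \<comment> \<open>Floor plus one strictly exceeds the quotient. As \<open>ln (1 - p)\<close> is
    negative, clearing the denominator reverses the inequality and yields \<open>q\<close> strictly
    below \<epsilon>, the gap that the Chernoff parameter needs.\<close>
  have "ln \<epsilon> / ln (1 - p) < real m"
    using assms(4) unfolding p_def by linarith
  then have "real m * ln (1 - p) < ln \<epsilon>"
    using p by (simp add: field_simps)
  then have "ln q < ln \<epsilon>"
    using p by (simp add: q_def ln_realpow)
  then have q: "0 < q" "q < \<epsilon>"
    using p assms(2) by (auto simp: q_def)
  obtain t where t: "1 < t" "1 + (t - 1) * q < t powr \<epsilon>"
    using exists_chernoff_parameter[OF q(2)] by blast
  have "0 < 1 + (t - 1) * q" using t(1) q(1) by (simp add: add_pos_pos)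
  \<comment> \<open>The gap between the bases absorbs the polynomial number of patterns. The
    threshold is fixed before any family of blocks is given.\<close>
  from eventually_poly_times_power_less[OF this t(2), of "real (r\<^sup>2)" "DIM(real ^ 'n) * m"]
  obtain N0 where N0: "\<And>N. N \<ge> N0 \<Longrightarrow> (real N * real (r\<^sup>2) + 1) ^ (DIM(real ^ 'n) * m)
      * (1 + (t - 1) * q) ^ N < (t powr \<epsilon>) ^ N"
    by (auto simp: eventually_sequentially)
  have pw: "(t powr \<epsilon>) ^ N = t powr (\<epsilon> * real N)" for N
    using t(1) by (simp add: powr_powr flip: powr_realpow)
  show ?thesis
  proof (intro exI[of _ N0] allI impI)
    fix N and B :: "nat \<Rightarrow> nat \<Rightarrow> nat \<Rightarrow> real ^ 'n"
    assume "N0 \<le> N" and "\<forall>b<N. is_block r (B b)"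
    then show "\<exists>P. (\<forall>k<m. family_transversal r N (P k)) \<and>
      (\<forall>G \<subseteq> {..<N}. real (card G) > \<epsilon> * real N \<longrightarrow>
        (\<exists>k<m. 0 \<in> convex hull (transversal_points B (P k) G)))"
      using N0[of N] t(1) p unfolding pw q_def p_def
      by (intro exists_transversals[of N r B t]) auto
  qed
qed

end
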